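(* Let $(\boldsymbol{X},\boldsymbol{T})$ be a nonautonomous dynamical system, let $Z\subset X_0$ and let $\boldsymbol{f}\in\boldsymbol{C}(\boldsymbol{X},\mathbb{R})$. Then (1) $P^{\mathrm{B}}(\boldsymbol{T},\boldsymbol{f},Z)\le\underline{Q}(\boldsymbol{T},\boldsymbol{f},Z)\le\overline{Q}(\boldsymbol{T},\boldsymbol{f},Z)$; (2) $P^{\mathrm{B}}(\boldsymbol{T},\boldsymbol{f},Z)\le\underline{P}(\boldsymbol{T},\boldsymbol{f},Z)\le\overline{P}(\boldsymbol{T},\boldsymbol{f},Z)$; (3) $P^{\mathrm{B}}(\boldsymbol{T},\boldsymbol{f},Z)\le P^{\mathrm{P}}(\boldsymbol{T},\boldsymbol{f},Z)\le\overline{P}(\boldsymbol{T},\boldsymbol{f},Z)$.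
   Context: A nonautonomous dynamical system (NDS) $(\boldsymbol{X},\boldsymbol{T})$ consists of a sequence $\boldsymbol{X}=\{X_k\}_{k=0}^\infty$ of compact metric spaces $(X_k,d_k)$ and a sequence $\boldsymbol{T}=\{T_k\}_{k=0}^\infty$ of continuous maps $T_k:X_k\to X_{k+1}$. Write $\boldsymbol{T}^0=\mathrm{id}_{X_0}$ and $\boldsymbol{T}^j=T_{j-1}\circ\cdots\circ T_0:X_0\to X_j$. For $n\ge 1$ the $n$-th Bowen metric on $X_0$ is $d_n^{\boldsymbol{T}}(x,y)=\max_{0\le j\le n-1}d_j(\boldsymbol{T}^jx,\boldsymbol{T}^jy)$; $B_n^{\boldsymbol{T}}(x,\varepsilon)=\{y\in X_0:d_n^{\boldsymbol{T}}(x,y)<\varepsilon\}$ and $\overline{B}_n^{\boldsymbol{T}}(x,\varepsilon)=\{y\in X_0:d_n^{\boldsymbol{T}}(x,y)\le\varepsilon\}$ are the open and closed Bowen balls. $\boldsymbol{C}(\boldsymbol{X},\mathbb{R})=\prod_{k\ge 0}C(X_k,\mathbb{R})$ is the set of sequences $\boldsymbol{f}=\{f_k\}_{k=0}^\infty$ of continuous functions $f_k:X_k\to\mathbb{R}$, and $S_n^{\boldsymbol{T}}\boldsymbol{f}=\sum_{j=0}^{n-1}f_j\circ\boldsymbol{T}^j$. Spanning and separated pressures. For $Z\subset X_0$, $n\ge1$, $\varepsilon>0$: $F\subset X_0$ is $(n,\varepsilon)$-spanning for $Z$ if for every $x\in Z$ there is $y\in F$ with $d_n^{\boldsymbol{T}}(x,y)\le\varepsilon$;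 $E\subset Z$ is $(n,\varepsilon)$-separated for $Z$ if $d_n^{\boldsymbol{T}}(x,y)>\varepsilon$ for all distinct $x,y\in E$. Let $Q_n(\boldsymbol{T},\boldsymbol{f},Z,\varepsilon)=\inf_F\sum_{x\in F}e^{S_n^{\boldsymbol{T}}\boldsymbol{f}(x)}$ over $(n,\varepsilon)$-spanning sets $F$ for $Z$ and $P_n(\boldsymbol{T},\boldsymbol{f},Z,\varepsilon)=\sup_E\sum_{x\in E}e^{S_n^{\boldsymbol{T}}\boldsymbol{f}(x)}$ over $(n,\varepsilon)$-separated sets $E$ for $Z$. Let $\underline{Q}(\boldsymbol{T},\boldsymbol{f},Z,\varepsilon)$, $\overline{Q}(\boldsymbol{T},\boldsymbol{f},Z,\varepsilon)$ be the $\liminf$, $\limsup$ as $n\to\infty$ of $\frac1n\log Q_n(\boldsymbol{T},\boldsymbol{f},Z,\varepsilon)$, and $\underline{P}(\boldsymbol{T},\boldsymbol{f},Z,\varepsilon)$, $\overline{P}(\boldsymbol{T},\boldsymbol{f},Z,\varepsilon)$ those of $\frac1n\log P_n(\boldsymbol{T},\boldsymbol{f},Z,\varepsilon)$ ($\log 0=-\infty$). Then $\underline{Q},\overline{Q},\underline{P},\overline{P}(\boldsymbol{T},\boldsymbol{f},Z)$ are the (monotone) limits of these as $\varepsilon\to0$. Bowen pressure. For $s\in\mathbb{R}$, $N>0$, $\varepsilon>0$ let $\mathscr{R}^s_{N,\varepsilon}(\boldsymbol{T},\boldsymbol{f},Z)=\inf\sum_i\exp(-n_is+S_{n_i}^{\boldsymbol{T}}\boldsymbol{f}(x_i))$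 over all countable families $\{B_{n_i}^{\boldsymbol{T}}(x_i,\varepsilon)\}_i$ with $n_i\ge N$, $x_i\in X_0$, covering $Z$. Put $\mathscr{R}^s_\varepsilon=\lim_{N\to\infty}\mathscr{R}^s_{N,\varepsilon}$, $P^{\mathrm{B}}(\boldsymbol{T},\boldsymbol{f},Z,\varepsilon)=\inf\{s:\mathscr{R}^s_\varepsilon(\boldsymbol{T},\boldsymbol{f},Z)=0\}=\sup\{s:\mathscr{R}^s_\varepsilon(\boldsymbol{T},\boldsymbol{f},Z)=+\infty\}$, and $P^{\mathrm{B}}(\boldsymbol{T},\boldsymbol{f},Z)=\lim_{\varepsilon\to0}P^{\mathrm{B}}(\boldsymbol{T},\boldsymbol{f},Z,\varepsilon)$. Packing pressure. Let $\mathscr{P}^s_{N,\varepsilon}(\boldsymbol{T},\boldsymbol{f},Z)=\sup\sum_i\exp(-n_is+S_{n_i}^{\boldsymbol{T}}\boldsymbol{f}(x_i))$ over all (at most) countable pairwise disjoint families $\{\overline{B}_{n_i}^{\boldsymbol{T}}(x_i,\varepsilon)\}_i$ with $x_i\in Z$, $n_i\ge N$. Put $\mathscr{P}^s_{\infty,\varepsilon}=\lim_{N\to\infty}\mathscr{P}^s_{N,\varepsilon}$, $\mathscr{P}^s_\varepsilon(\boldsymbol{T},\boldsymbol{f},Z)=\inf\{\sum_{i=1}^\infty\mathscr{P}^s_{\infty,\varepsilon}(\boldsymbol{T},\boldsymbol{f},Z_i):\bigcup_iZ_i\supset Z\}$, $P^{\mathrm{P}}(\boldsymbol{T},\boldsymbol{f},Z,\varepsilon)=\inf\{s:\mathscr{P}^s_\varepsilon(\boldsymbol{T},\boldsymbol{f},Z)=0\}=\sup\{s:\mathscr{P}^s_\varepsilon(\boldsymbol{T},\boldsymbol{f},Z)=+\infty\}$,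 and $P^{\mathrm{P}}(\boldsymbol{T},\boldsymbol{f},Z)=\lim_{\varepsilon\to0}P^{\mathrm{P}}(\boldsymbol{T},\boldsymbol{f},Z,\varepsilon)$. All pressures take values in $\mathbb{R}\cup\{\pm\infty\}$. *)

theory Defs
  imports "HOL-Analysis.Analysis"
begin

text \<open>
  The spaces of a nonautonomous system may be entirely unrelated. They are given as
  a sequence of values of type \<^typ>\<open>'a metric\<close>, each with its own carrier and its own
  distance; since an arbitrary sequence of metric spaces embeds in its disjoint union, one
  ambient type \<^typ>\<open>'a\<close> is no restriction. The values of the maps outside the
  carriers are irrelevant.
\<close>

definition nds :: "(nat \<Rightarrow> 'a metric) \<Rightarrow> (nat \<Rightarrow> 'a \<Rightarrow> 'a) \<Rightarrow> bool" where
  "nds X T \<longleftrightarrow>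
     (\<forall>k. compact_space (mtopology_of (X k))) \<and>
     (\<forall>k. continuous_map (mtopology_of (X k)) (mtopology_of (X (Suc k))) (T k))"

definition cont_seq :: "(nat \<Rightarrow> 'a metric) \<Rightarrow> (nat \<Rightarrow> 'a \<Rightarrow> real) set" where
  "cont_seq X = {f. \<forall>k. continuous_map (mtopology_of (X k)) euclideanreal (f k)}"

primrec orbit_map :: "(nat \<Rightarrow> 'a \<Rightarrow> 'a) \<Rightarrow> nat \<Rightarrow> 'a \<Rightarrow> 'a" where
  "orbit_map T 0 = id"
| "orbit_map T (Suc j) = T j \<circ> orbit_map T j"

definition birkhoff_sum :: "(nat \<Rightarrow> 'a \<Rightarrow> 'a) \<Rightarrow> (nat \<Rightarrow> 'a \<Rightarrow> real) \<Rightarrow> nat \<Rightarrow> 'a \<Rightarrow> real" where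
  "birkhoff_sum T f n x = (\<Sum>j<n. f j (orbit_map T j x))"

text \<open>
  The Bowen metric is meaningful for \<open>n \<ge> 1\<close> only; for \<open>n = 0\<close> the maximum is
  taken over the empty set. All pressures below are limits in which \<open>n = 0\<close> plays no role.
\<close>

definition bowen_dist ::
    "(nat \<Rightarrow> 'a metric) \<Rightarrow> (nat \<Rightarrow> 'a \<Rightarrow> 'a) \<Rightarrow> nat \<Rightarrow> 'a \<Rightarrow> 'a \<Rightarrow> real" where
  "bowen_dist X T n x y =
     Max ((\<lambda>j. mdist (X j) (orbit_map T j x) (orbit_map T j y)) ` {..<n})"

definition bowen_ball ::
    "(nat \<Rightarrow> 'a metric) \<Rightarrow> (nat \<Rightarrow> 'a \<Rightarrow> 'a) \<Rightarrow> nat \<Rightarrow> 'a \<Rightarrow> real \<Rightarrow> 'a set" where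
  "bowen_ball X T n x \<epsilon> = {y \<in> mspace (X 0). bowen_dist X T n x y < \<epsilon>}"

definition bowen_cball ::
    "(nat \<Rightarrow> 'a metric) \<Rightarrow> (nat \<Rightarrow> 'a \<Rightarrow> 'a) \<Rightarrow> nat \<Rightarrow> 'a \<Rightarrow> real \<Rightarrow> 'a set" where
  "bowen_cball X T n x \<epsilon> = {y \<in> mspace (X 0). bowen_dist X T n x y \<le> \<epsilon>}"

definition log_ennreal :: "ennreal \<Rightarrow> ereal" where
  "log_ennreal a = (if a = 0 then -\<infinity> else if a = top then \<infinity> else ereal (ln (enn2real a)))"


subsection \<open>Spanning and separated pressures\<close>

definition spanning ::
    "(nat \<Rightarrow> 'a metric) \<Rightarrow> (nat \<Rightarrow> 'a \<Rightarrow> 'a) \<Rightarrow> 'a set \<Rightarrow> nat \<Rightarrow> real \<Rightarrow> 'a set \<Rightarrow> bool" where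
  "spanning X T Z n \<epsilon> F \<longleftrightarrow>
     F \<subseteq> mspace (X 0) \<and> (\<forall>x\<in>Z. \<exists>y\<in>F. bowen_dist X T n x y \<le> \<epsilon>)"

definition separated ::
    "(nat \<Rightarrow> 'a metric) \<Rightarrow> (nat \<Rightarrow> 'a \<Rightarrow> 'a) \<Rightarrow> 'a set \<Rightarrow> nat \<Rightarrow> real \<Rightarrow> 'a set \<Rightarrow> bool" where
  "separated X T Z n \<epsilon> E \<longleftrightarrow>
     E \<subseteq> Z \<and> (\<forall>x\<in>E. \<forall>y\<in>E. x \<noteq> y \<longrightarrow> bowen_dist X T n x y > \<epsilon>)"

definition spanning_sum ::
    "(nat \<Rightarrow> 'a metric) \<Rightarrow> (nat \<Rightarrow> 'a \<Rightarrow> 'a) \<Rightarrow> (nat \<Rightarrow> 'a \<Rightarrow> real) \<Rightarrow> 'a set \<Rightarrow> nat \<Rightarrow> real \<Rightarrow> ennreal"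
  where
  "spanning_sum X T f Z n \<epsilon> =
     (INF F\<in>{F. spanning X T Z n \<epsilon> F}. \<Sum>\<^sub>\<infinity>x\<in>F. ennreal (exp (birkhoff_sum T f n x)))"

definition separated_sum ::
    "(nat \<Rightarrow> 'a metric) \<Rightarrow> (nat \<Rightarrow> 'a \<Rightarrow> 'a) \<Rightarrow> (nat \<Rightarrow> 'a \<Rightarrow> real) \<Rightarrow> 'a set \<Rightarrow> nat \<Rightarrow> real \<Rightarrow> ennreal"
  where
  "separated_sum X T f Z n \<epsilon> =
     (SUP E\<in>{E. separated X T Z n \<epsilon> E}. \<Sum>\<^sub>\<infinity>x\<in>E. ennreal (exp (birkhoff_sum T f n x)))"

definition lower_Q_at ::
    "(nat \<Rightarrow> 'a metric) \<Rightarrow> (nat \<Rightarrow> 'a \<Rightarrow> 'a) \<Rightarrow> (nat \<Rightarrow> 'a \<Rightarrow> real) \<Rightarrow> 'a set \<Rightarrow> real \<Rightarrow> ereal"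
  where
  "lower_Q_at X T f Z \<epsilon> =
     liminf (\<lambda>n. ereal (1 / real n) * log_ennreal (spanning_sum X T f Z n \<epsilon>))"

definition upper_Q_at ::
    "(nat \<Rightarrow> 'a metric) \<Rightarrow> (nat \<Rightarrow> 'a \<Rightarrow> 'a) \<Rightarrow> (nat \<Rightarrow> 'a \<Rightarrow> real) \<Rightarrow> 'a set \<Rightarrow> real \<Rightarrow> ereal"
  where
  "upper_Q_at X T f Z \<epsilon> =
     limsup (\<lambda>n. ereal (1 / real n) * log_ennreal (spanning_sum X T f Z n \<epsilon>))"

definition lower_P_at ::
    "(nat \<Rightarrow> 'a metric) \<Rightarrow> (nat \<Rightarrow> 'a \<Rightarrow> 'a) \<Rightarrow> (nat \<Rightarrow> 'a \<Rightarrow> real) \<Rightarrow> 'a set \<Rightarrow> real \<Rightarrow> ereal"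
  where
  "lower_P_at X T f Z \<epsilon> =
     liminf (\<lambda>n. ereal (1 / real n) * log_ennreal (separated_sum X T f Z n \<epsilon>))"

definition upper_P_at ::
    "(nat \<Rightarrow> 'a metric) \<Rightarrow> (nat \<Rightarrow> 'a \<Rightarrow> 'a) \<Rightarrow> (nat \<Rightarrow> 'a \<Rightarrow> real) \<Rightarrow> 'a set \<Rightarrow> real \<Rightarrow> ereal"
  where
  "upper_P_at X T f Z \<epsilon> =
     limsup (\<lambda>n. ereal (1 / real n) * log_ennreal (separated_sum X T f Z n \<epsilon>))"

definition lower_Q ::
    "(nat \<Rightarrow> 'a metric) \<Rightarrow> (nat \<Rightarrow> 'a \<Rightarrow> 'a) \<Rightarrow> (nat \<Rightarrow> 'a \<Rightarrow> real) \<Rightarrow> 'a set \<Rightarrow> ereal" where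
  "lower_Q X T f Z = Lim (at_right 0) (\<lambda>\<epsilon>. lower_Q_at X T f Z \<epsilon>)"

definition upper_Q ::
    "(nat \<Rightarrow> 'a metric) \<Rightarrow> (nat \<Rightarrow> 'a \<Rightarrow> 'a) \<Rightarrow> (nat \<Rightarrow> 'a \<Rightarrow> real) \<Rightarrow> 'a set \<Rightarrow> ereal" where
  "upper_Q X T f Z = Lim (at_right 0) (\<lambda>\<epsilon>. upper_Q_at X T f Z \<epsilon>)"

definition lower_P ::
    "(nat \<Rightarrow> 'a metric) \<Rightarrow> (nat \<Rightarrow> 'a \<Rightarrow> 'a) \<Rightarrow> (nat \<Rightarrow> 'a \<Rightarrow> real) \<Rightarrow> 'a set \<Rightarrow> ereal" where
  "lower_P X T f Z = Lim (at_right 0) (\<lambda>\<epsilon>. lower_P_at X T f Z \<epsilon>)"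

definition upper_P ::
    "(nat \<Rightarrow> 'a metric) \<Rightarrow> (nat \<Rightarrow> 'a \<Rightarrow> 'a) \<Rightarrow> (nat \<Rightarrow> 'a \<Rightarrow> real) \<Rightarrow> 'a set \<Rightarrow> ereal" where
  "upper_P X T f Z = Lim (at_right 0) (\<lambda>\<epsilon>. upper_P_at X T f Z \<epsilon>)"


subsection \<open>Bowen pressure\<close>

text \<open>
  An at most countable family of Bowen balls is indexed by a set \<open>I\<close> of natural
  numbers, finite or infinite, with lengths \<open>\<nu> i\<close> and centres \<open>x i\<close>.
\<close>

definition bowen_weight ::
    "(nat \<Rightarrow> 'a \<Rightarrow> 'a) \<Rightarrow> (nat \<Rightarrow> 'a \<Rightarrow> real) \<Rightarrow> real \<Rightarrow> nat \<Rightarrow> 'a \<Rightarrow> ennreal" where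
  "bowen_weight T f s n x = ennreal (exp (- real n * s + birkhoff_sum T f n x))"

definition bowen_outer_N ::
    "(nat \<Rightarrow> 'a metric) \<Rightarrow> (nat \<Rightarrow> 'a \<Rightarrow> 'a) \<Rightarrow> (nat \<Rightarrow> 'a \<Rightarrow> real) \<Rightarrow> 'a set \<Rightarrow> real \<Rightarrow> real \<Rightarrow> nat
     \<Rightarrow> ennreal" where
  "bowen_outer_N X T f Z \<epsilon> s N =
     Inf {\<Sum>\<^sub>\<infinity>i\<in>I. bowen_weight T f s (\<nu> i) (x i) | (I :: nat set) \<nu> x.
            (\<forall>i\<in>I. N \<le> \<nu> i \<and> x i \<in> mspace (X 0)) \<and>
            Z \<subseteq> (\<Union>i\<in>I. bowen_ball X T (\<nu> i) (x i) \<epsilon>)}"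

definition bowen_outer ::
    "(nat \<Rightarrow> 'a metric) \<Rightarrow> (nat \<Rightarrow> 'a \<Rightarrow> 'a) \<Rightarrow> (nat \<Rightarrow> 'a \<Rightarrow> real) \<Rightarrow> 'a set \<Rightarrow> real \<Rightarrow> real \<Rightarrow> ennreal"
  where
  "bowen_outer X T f Z \<epsilon> s = lim (\<lambda>N. bowen_outer_N X T f Z \<epsilon> s N)"

definition bowen_pressure_at ::
    "(nat \<Rightarrow> 'a metric) \<Rightarrow> (nat \<Rightarrow> 'a \<Rightarrow> 'a) \<Rightarrow> (nat \<Rightarrow> 'a \<Rightarrow> real) \<Rightarrow> 'a set \<Rightarrow> real \<Rightarrow> ereal"
  where
  "bowen_pressure_at X T f Z \<epsilon> = Inf (ereal ` {s. bowen_outer X T f Z \<epsilon> s = 0})"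

definition bowen_pressure ::
    "(nat \<Rightarrow> 'a metric) \<Rightarrow> (nat \<Rightarrow> 'a \<Rightarrow> 'a) \<Rightarrow> (nat \<Rightarrow> 'a \<Rightarrow> real) \<Rightarrow> 'a set \<Rightarrow> ereal" where
  "bowen_pressure X T f Z = Lim (at_right 0) (\<lambda>\<epsilon>. bowen_pressure_at X T f Z \<epsilon>)"


subsection \<open>Packing pressure\<close>

definition packing_N ::
    "(nat \<Rightarrow> 'a metric) \<Rightarrow> (nat \<Rightarrow> 'a \<Rightarrow> 'a) \<Rightarrow> (nat \<Rightarrow> 'a \<Rightarrow> real) \<Rightarrow> 'a set \<Rightarrow> real \<Rightarrow> real \<Rightarrow> nat
     \<Rightarrow> ennreal" where
  "packing_N X T f Z \<epsilon> s N =
     Sup {\<Sum>\<^sub>\<infinity>i\<in>I. bowen_weight T f s (\<nu> i) (x i) | (I :: nat set) \<nu> x.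
            (\<forall>i\<in>I. N \<le> \<nu> i \<and> x i \<in> Z) \<and>
            disjoint_family_on (\<lambda>i. bowen_cball X T (\<nu> i) (x i) \<epsilon>) I}"

definition packing_pre ::
    "(nat \<Rightarrow> 'a metric) \<Rightarrow> (nat \<Rightarrow> 'a \<Rightarrow> 'a) \<Rightarrow> (nat \<Rightarrow> 'a \<Rightarrow> real) \<Rightarrow> 'a set \<Rightarrow> real \<Rightarrow> real \<Rightarrow> ennreal"
  where
  "packing_pre X T f Z \<epsilon> s = lim (\<lambda>N. packing_N X T f Z \<epsilon> s N)"

definition packing_outer ::
    "(nat \<Rightarrow> 'a metric) \<Rightarrow> (nat \<Rightarrow> 'a \<Rightarrow> 'a) \<Rightarrow> (nat \<Rightarrow> 'a \<Rightarrow> real) \<Rightarrow> 'a set \<Rightarrow> real \<Rightarrow> real \<Rightarrow> ennreal"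
  where
  "packing_outer X T f Z \<epsilon> s =
     Inf {\<Sum>i. packing_pre X T f (Y i) \<epsilon> s | Y :: nat \<Rightarrow> 'a set.
            (\<forall>i. Y i \<subseteq> mspace (X 0)) \<and> Z \<subseteq> (\<Union>i. Y i)}"

definition packing_pressure_at ::
    "(nat \<Rightarrow> 'a metric) \<Rightarrow> (nat \<Rightarrow> 'a \<Rightarrow> 'a) \<Rightarrow> (nat \<Rightarrow> 'a \<Rightarrow> real) \<Rightarrow> 'a set \<Rightarrow> real \<Rightarrow> ereal"
  where
  "packing_pressure_at X T f Z \<epsilon> = Inf (ereal ` {s. packing_outer X T f Z \<epsilon> s = 0})"

definition packing_pressure ::
    "(nat \<Rightarrow> 'a metric) \<Rightarrow> (nat \<Rightarrow> 'a \<Rightarrow> 'a) \<Rightarrow> (nat \<Rightarrow> 'a \<Rightarrow> real) \<Rightarrow> 'a set \<Rightarrow> ereal" where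
  "packing_pressure X T f Z = Lim (at_right 0) (\<lambda>\<epsilon>. packing_pressure_at X T f Z \<epsilon>)"


subsection \<open>The limits exist and the two descriptions of the critical exponents agree\<close>

text \<open>
  By monotonicity, every \<^const>\<open>lim\<close> and \<^const>\<open>Lim\<close> above is attained as a
  genuine limit, and the infimum that defines \<^const>\<open>bowen_pressure_at\<close> and
  \<^const>\<open>packing_pressure_at\<close> equals the supremum of the exponents with infinite value.
\<close>


lemma tendsto_at_right_antimono:
  fixes g :: "real \<Rightarrow> ereal"
  assumes "\<And>a b. 0 < a \<Longrightarrow> a \<le> b \<Longrightarrow> g b \<le> g a"
  shows "(g \<longlongrightarrow> (SUP e\<in>{0<..}. g e)) (at_right 0)"
proof (rule increasing_tendsto)
  show "\<forall>\<^sub>F n in at_right 0. g n \<le> Sup (g ` {0<..})"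
    unfolding eventually_at_right_field by (intro exI[of _ 1]) (auto intro: SUP_upper)
next
  fix x assume "x < Sup (g ` {0<..})"
  then obtain e where e: "0 < e" "x < g e" by (auto simp: less_SUP_iff)
  show "\<forall>\<^sub>F n in at_right 0. x < g n"
    unfolding eventually_at_right_field
    by (intro exI[of _ e]) (use e assms in \<open>auto intro: less_le_trans\<close>)
qed

lemma log_ennreal_mono: "a \<le> b \<Longrightarrow> log_ennreal a \<le> log_ennreal b"
  unfolding log_ennreal_def
  by (cases a; cases b) (auto simp: top_unique ennreal_eq_0_iff less_le)

lemma spanning_sum_antimono: "a \<le> b \<Longrightarrow> spanning_sum X T f Z n b \<le> spanning_sum X T f Z n a"
  unfolding spanning_sum_def by (rule INF_superset_mono) (force simp: spanning_def)+

lemma separated_sum_antimono: "a \<le> b \<Longrightarrow> separated_sum X T f Z n b \<le> separated_sum X T f Z n a"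
  unfolding separated_sum_def by (rule SUP_subset_mono) (force simp: separated_def)+

lemma scaled_log_mono:
  "a \<le> b \<Longrightarrow> ereal (1 / real n) * log_ennreal a \<le> ereal (1 / real n) * log_ennreal b"
  by (intro ereal_mult_left_mono log_ennreal_mono) auto

lemma Q_P_tendsto:
  "((\<lambda>\<epsilon>. lower_Q_at X T f Z \<epsilon>) \<longlongrightarrow> lower_Q X T f Z) (at_right 0)"
  "((\<lambda>\<epsilon>. upper_Q_at X T f Z \<epsilon>) \<longlongrightarrow> upper_Q X T f Z) (at_right 0)"
  "((\<lambda>\<epsilon>. lower_P_at X T f Z \<epsilon>) \<longlongrightarrow> lower_P X T f Z) (at_right 0)"
  "((\<lambda>\<epsilon>. upper_P_at X T f Z \<epsilon>) \<longlongrightarrow> upper_P X T f Z) (at_right 0)"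
proof -
  have *: "((\<lambda>\<epsilon>. g \<epsilon>) \<longlongrightarrow> Lim (at_right 0) (\<lambda>\<epsilon>. g \<epsilon>)) (at_right 0)"
    if "\<And>a b. 0 < a \<Longrightarrow> a \<le> b \<Longrightarrow> g b \<le> g a" for g :: "real \<Rightarrow> ereal"
  proof -
    note t = tendsto_at_right_antimono[of g, OF that]
    show ?thesis using t tendsto_Lim[OF trivial_limit_at_right_real t] by simp
  qed
  show "((\<lambda>\<epsilon>. lower_Q_at X T f Z \<epsilon>) \<longlongrightarrow> lower_Q X T f Z) (at_right 0)"
    unfolding lower_Q_def lower_Q_at_def
    by (rule *) (intro Liminf_mono always_eventually allI scaled_log_mono spanning_sum_antimono)
  show "((\<lambda>\<epsilon>. upper_Q_at X T f Z \<epsilon>) \<longlongrightarrow> upper_Q X T f Z) (at_right 0)"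
    unfolding upper_Q_def upper_Q_at_def
    by (rule *) (intro Limsup_mono always_eventually allI scaled_log_mono spanning_sum_antimono)
  show "((\<lambda>\<epsilon>. lower_P_at X T f Z \<epsilon>) \<longlongrightarrow> lower_P X T f Z) (at_right 0)"
    unfolding lower_P_def lower_P_at_def
    by (rule *) (intro Liminf_mono always_eventually allI scaled_log_mono separated_sum_antimono)
  show "((\<lambda>\<epsilon>. upper_P_at X T f Z \<epsilon>) \<longlongrightarrow> upper_P X T f Z) (at_right 0)"
    unfolding upper_P_def upper_P_at_def
    by (rule *) (intro Limsup_mono always_eventually allI scaled_log_mono separated_sum_antimono)
qed

lemma bowen_outer_N_mono: "N \<le> M \<Longrightarrow> bowen_outer_N X T f Z \<epsilon> s N \<le> bowen_outer_N X T f Z \<epsilon> s M"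
  unfolding bowen_outer_N_def by (rule Inf_superset_mono) (blast intro: order_trans)

lemma packing_N_antimono: "N \<le> M \<Longrightarrow> packing_N X T f Z \<epsilon> s M \<le> packing_N X T f Z \<epsilon> s N"
  unfolding packing_N_def by (rule Sup_subset_mono) (blast intro: order_trans)

lemma bowen_outer_tendsto:
  "(\<lambda>N. bowen_outer_N X T f Z \<epsilon> s N) \<longlonglongrightarrow> bowen_outer X T f Z \<epsilon> s"
  unfolding bowen_outer_def convergent_LIMSEQ_iff[symmetric]
  by (rule convergentI, rule LIMSEQ_SUP) (simp add: incseq_def bowen_outer_N_mono)

lemma packing_pre_tendsto:
  "(\<lambda>N. packing_N X T f Z \<epsilon> s N) \<longlonglongrightarrow> packing_pre X T f Z \<epsilon> s"
  unfolding packing_pre_def convergent_LIMSEQ_iff[symmetric]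
  by (rule convergentI, rule LIMSEQ_INF) (simp add: decseq_def packing_N_antimono)

lemma bowen_outer_antimono_eps:
  assumes "a \<le> b" shows "bowen_outer X T f Z b s \<le> bowen_outer X T f Z a s"
proof (rule LIMSEQ_le[OF bowen_outer_tendsto bowen_outer_tendsto], intro exI[of _ 0] allI impI)
  fix N
  have *: "(\<Union>i\<in>I. bowen_ball X T (\<nu> i) (x i) a) \<subseteq> (\<Union>i\<in>I. bowen_ball X T (\<nu> i) (x i) b)"
    for I :: "nat set" and \<nu> x
    by (rule UN_mono) (use assms in \<open>auto simp: bowen_ball_def\<close>)
  show "bowen_outer_N X T f Z b s N \<le> bowen_outer_N X T f Z a s N"
    unfolding bowen_outer_N_def
    by (rule Inf_superset_mono, clarify, intro exI conjI, rule refl, assumption,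
        erule order_trans, rule *)
qed

lemma packing_pre_antimono_eps:
  assumes "a \<le> b" shows "packing_pre X T f Z b s \<le> packing_pre X T f Z a s"
proof (rule LIMSEQ_le[OF packing_pre_tendsto packing_pre_tendsto], intro exI[of _ 0] allI impI)
  fix N
  have *: "disjoint_family_on (\<lambda>i. bowen_cball X T (\<nu> i) (x i) a) I"
    if "disjoint_family_on (\<lambda>i. bowen_cball X T (\<nu> i) (x i) b) I"
    for I :: "nat set" and \<nu> x 
  proof -
    have "bowen_cball X T (\<nu> i) (x i) a \<subseteq> bowen_cball X T (\<nu> i) (x i) b" for i
      using assms by (auto simp: bowen_cball_def)
    with that show ?thesis unfolding disjoint_family_on_def by blast
  qed
  show "packing_N X T f Z b s N \<le> packing_N X T f Z a s N"
    unfolding packing_N_def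
    by (rule Sup_subset_mono, clarify, intro exI conjI, rule refl, assumption, erule *)
qed

lemma packing_outer_antimono_eps:
  fixes X :: "nat \<Rightarrow> 'a metric"
  assumes "a \<le> b" shows "packing_outer X T f Z b s \<le> packing_outer X T f Z a s"
  unfolding packing_outer_def
proof (rule Inf_greatest, clarsimp)
  fix Y :: "nat \<Rightarrow> 'a set" assume Y: "\<forall>i. Y i \<subseteq> mspace (X 0)" "Z \<subseteq> (\<Union>i. Y i)"
  have "(\<Sum>i. packing_pre X T f (Y i) b s) \<le> (\<Sum>i. packing_pre X T f (Y i) a s)"
    by (intro suminf_le packing_pre_antimono_eps assms) auto
  with Y show "Inf {\<Sum>i. packing_pre X T f (Y i) b s |Y. (\<forall>i. Y i \<subseteq> mspace (X 0)) \<and> Z \<subseteq> \<Union> (range Y)}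
         \<le> (\<Sum>i. packing_pre X T f (Y i) a s)"
    by (blast intro: Inf_lower2)
qed

lemma bowen_packing_pressure_tendsto:
  "((\<lambda>\<epsilon>. bowen_pressure_at X T f Z \<epsilon>) \<longlongrightarrow> bowen_pressure X T f Z) (at_right 0)"
  "((\<lambda>\<epsilon>. packing_pressure_at X T f Z \<epsilon>) \<longlongrightarrow> packing_pressure X T f Z) (at_right 0)"
proof -
  have 1: "bowen_pressure_at X T f Z b \<le> bowen_pressure_at X T f Z a" if "a \<le> b" for a b
    unfolding bowen_pressure_at_def
    by (intro Inf_superset_mono image_mono) (use bowen_outer_antimono_eps[OF that, of X T f Z] in \<open>auto simp: le_zero_eq\<close>, metis le_zero_eq)
  have 2: "packing_pressure_at X T f Z b \<le> packing_pressure_at X T f Z a" if "a \<le> b" for a b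
    unfolding packing_pressure_at_def
    by (intro Inf_superset_mono image_mono) (use packing_outer_antimono_eps[OF that, of X T f Z] in \<open>auto simp: le_zero_eq\<close>, metis le_zero_eq)
  have "((\<lambda>\<epsilon>. bowen_pressure_at X T f Z \<epsilon>) \<longlongrightarrow> (SUP e\<in>{0<..}. bowen_pressure_at X T f Z e)) (at_right 0)"
    by (rule tendsto_at_right_antimono) (rule 1)
  then show "((\<lambda>\<epsilon>. bowen_pressure_at X T f Z \<epsilon>) \<longlongrightarrow> bowen_pressure X T f Z) (at_right 0)"
    unfolding bowen_pressure_def by (metis tendsto_Lim trivial_limit_at_right_real)
  have "((\<lambda>\<epsilon>. packing_pressure_at X T f Z \<epsilon>) \<longlongrightarrow> (SUP e\<in>{0<..}. packing_pressure_at X T f Z e)) (at_right 0)"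
    by (rule tendsto_at_right_antimono) (rule 2)
  then show "((\<lambda>\<epsilon>. packing_pressure_at X T f Z \<epsilon>) \<longlongrightarrow> packing_pressure X T f Z) (at_right 0)"
    unfolding packing_pressure_def by (metis tendsto_Lim trivial_limit_at_right_real)
qed

lemma critical_value_eq:
  fixes h :: "real \<Rightarrow> ennreal"
  assumes "\<And>s t. s < t \<Longrightarrow> h s \<noteq> top \<Longrightarrow> h t = 0"
  shows "Inf (ereal ` {s. h s = 0}) = Sup (ereal ` {s. h s = top})"
proof (rule antisym)
  show "Sup (ereal ` {s. h s = top}) \<le> Inf (ereal ` {s. h s = 0})"
  proof (rule Sup_least, rule Inf_greatest, clarsimp)
    fix s t assume "h s = top" "h t = 0"
    then show "s \<le> t" using assms[of t s] by (cases "t < s") auto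
  qed
  show "Inf (ereal ` {s. h s = 0}) \<le> Sup (ereal ` {s. h s = top})"
  proof (rule dense_le)
    fix y assume y: "y < Inf (ereal ` {s. h s = 0})"
    show "y \<le> Sup (ereal ` {s. h s = top})"
    proof (rule ccontr)
      assume "\<not> y \<le> Sup (ereal ` {s. h s = top})"
      then have a: "Sup (ereal ` {s. h s = top}) < y" by simp
      obtain r where r: "Sup (ereal ` {s. h s = top}) < ereal r" "ereal r < y"
        using ereal_dense2[OF a] by auto
      obtain r' where r': "ereal r < ereal r'" "ereal r' < y" using ereal_dense2[OF r(2)] by auto
      have "h r \<noteq> top"
      proof
        assume "h r = top"
        then have "ereal r \<le> Sup (ereal ` {s. h s = top})" by (intro Sup_upper) auto
        with r(1) show False by (meson leD)
      qed
      then have "h r' = 0" using assms[of r r'] r'(1) by auto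
      then have "Inf (ereal ` {s. h s = 0}) \<le> ereal r'" by (intro Inf_lower) auto
      with y r'(2) show False by (meson leD less_trans)
    qed
  qed
qed

lemma weight_scale:
  assumes "s < t" "\<And>i. i \<in> I \<Longrightarrow> N \<le> \<nu> i"
  shows "(\<Sum>\<^sub>\<infinity>i\<in>I. bowen_weight T f t (\<nu> i) (x i))
       \<le> ennreal (exp (- real N * (t - s))) * (\<Sum>\<^sub>\<infinity>i\<in>I. bowen_weight T f s (\<nu> i) (x i))"
    (is "_ \<le> ?c * ?S")
proof -
  have w: "bowen_weight T f t (\<nu> i) (x i) \<le> ?c * bowen_weight T f s (\<nu> i) (x i)" if "i \<in> I" for i
  proof -
    have "real N * (t - s) \<le> real (\<nu> i) * (t - s)" using assms that by (intro mult_right_mono) auto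
    then show ?thesis unfolding bowen_weight_def
      by (simp flip: ennreal_mult exp_add add: algebra_simps)
  qed
  have "(\<Sum>i\<in>J. bowen_weight T f t (\<nu> i) (x i)) \<le> ?c * ?S" if "finite J" "J \<subseteq> I" for J
  proof -
    have "(\<Sum>i\<in>J. bowen_weight T f t (\<nu> i) (x i)) \<le> (\<Sum>i\<in>J. ?c * bowen_weight T f s (\<nu> i) (x i))"
      using that w by (intro sum_mono) auto
    also have "\<dots> = ?c * (\<Sum>i\<in>J. bowen_weight T f s (\<nu> i) (x i))" by (simp add: sum_distrib_left)
    also have "\<dots> \<le> ?c * ?S"
      using that by (intro mult_left_mono) (auto simp: nonneg_infsum_complete intro!: SUP_upper)
    finally show ?thesis .
  qed
  then show ?thesis by (subst nonneg_infsum_complete) (auto intro!: SUP_least)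
qed

lemma scale_tendsto_0:
  assumes "s < t" "(M::ennreal) \<noteq> top"
  shows "(\<lambda>N. ennreal (exp (- real N * (t - s))) * M) \<longlonglongrightarrow> 0"
proof -
  obtain m where m: "M = ennreal m" "0 \<le> m" using assms(2) by (cases M) auto
  have "(\<lambda>N. exp (- real N * (t - s)) * m) \<longlonglongrightarrow> 0"
  proof -
    have "(\<lambda>N. exp (-(t-s)) ^ N) \<longlonglongrightarrow> 0" using assms(1) by (intro LIMSEQ_realpow_zero) auto
    then have "(\<lambda>N. exp (- real N * (t - s))) \<longlonglongrightarrow> 0"
      by (simp flip: exp_of_nat_mult add: algebra_simps)
    then show ?thesis using tendsto_mult_left_zero by blast
  qed
  then have "(\<lambda>N. ennreal (exp (- real N * (t - s)) * m)) \<longlonglongrightarrow> ennreal 0"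
    by (rule tendsto_ennrealI)
  then show ?thesis using m by (simp add: ennreal_mult)
qed

lemma bowen_outer_jump:
  assumes "s < t" "bowen_outer X T f Z \<epsilon> s \<noteq> top"
  shows "bowen_outer X T f Z \<epsilon> t = 0"
proof -
  let ?M = "bowen_outer X T f Z \<epsilon> s + 1"
  have le: "bowen_outer_N X T f Z \<epsilon> s N \<le> bowen_outer X T f Z \<epsilon> s" for N
    by (rule incseq_le[OF _ bowen_outer_tendsto]) (simp add: incseq_def bowen_outer_N_mono)
  have "bowen_outer_N X T f Z \<epsilon> t N \<le> ennreal (exp (- real N * (t - s))) * ?M" for N
  proof -
    have "bowen_outer_N X T f Z \<epsilon> s N < ?M"
    proof (rule le_less_trans[OF le])
      show "bowen_outer X T f Z \<epsilon> s < ?M"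
        using assms(2) by (cases "bowen_outer X T f Z \<epsilon> s")
          (auto simp flip: ennreal_plus ennreal_1 simp: ennreal_less_iff)
    qed
    then obtain I :: "nat set" and \<nu> x where
      I: "\<forall>i\<in>I. N \<le> \<nu> i \<and> x i \<in> mspace (X 0)" "Z \<subseteq> (\<Union>i\<in>I. bowen_ball X T (\<nu> i) (x i) \<epsilon>)"
        "(\<Sum>\<^sub>\<infinity>i\<in>I. bowen_weight T f s (\<nu> i) (x i)) < ?M"
      unfolding bowen_outer_N_def Inf_less_iff by blast
    have "bowen_outer_N X T f Z \<epsilon> t N \<le> (\<Sum>\<^sub>\<infinity>i\<in>I. bowen_weight T f t (\<nu> i) (x i))"
      unfolding bowen_outer_N_def using I by (intro Inf_lower) blast
    also have "\<dots> \<le> ennreal (exp (- real N * (t - s))) * (\<Sum>\<^sub>\<infinity>i\<in>I. bowen_weight T f s (\<nu> i) (x i))"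
      using assms I by (intro weight_scale) auto
    also have "\<dots> \<le> ennreal (exp (- real N * (t - s))) * ?M" using I by (intro mult_left_mono) auto
    finally show ?thesis .
  qed
  then have "bowen_outer X T f Z \<epsilon> t \<le> 0"
    using assms by (intro LIMSEQ_le[OF bowen_outer_tendsto scale_tendsto_0[of s t ?M]]) auto
  then show ?thesis by simp
qed

lemma packing_pre_jump:
  assumes "s < t" "packing_pre X T f Z \<epsilon> s \<noteq> top"
  shows "packing_pre X T f Z \<epsilon> t = 0"
proof -
  have "\<forall>\<^sub>F N in sequentially. packing_N X T f Z \<epsilon> s N < top"
    using packing_pre_tendsto assms(2) by (intro order_tendstoD(2)) (auto simp: less_top)
  then obtain M where M: "packing_N X T f Z \<epsilon> s M < top" by (auto simp: eventually_sequentially)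
  have "packing_N X T f Z \<epsilon> t N \<le> ennreal (exp (- real N * (t - s))) * packing_N X T f Z \<epsilon> s M"
    if "M \<le> N" for N
  proof -
    have "packing_N X T f Z \<epsilon> t N \<le> ennreal (exp (- real N * (t - s))) * packing_N X T f Z \<epsilon> s N"
      unfolding packing_N_def
    proof (rule Sup_least, clarify)
      fix I :: "nat set" and \<nu> x
      assume I: "\<forall>i\<in>I. N \<le> \<nu> i \<and> x i \<in> Z" "disjoint_family_on (\<lambda>i. bowen_cball X T (\<nu> i) (x i) \<epsilon>) I"
      have "(\<Sum>\<^sub>\<infinity>i\<in>I. bowen_weight T f t (\<nu> i) (x i))
         \<le> ennreal (exp (- real N * (t - s))) * (\<Sum>\<^sub>\<infinity>i\<in>I. bowen_weight T f s (\<nu> i) (x i))"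
        using assms I by (intro weight_scale) auto
      also have "\<dots> \<le> ennreal (exp (- real N * (t - s))) * packing_N X T f Z \<epsilon> s N"
        unfolding packing_N_def using I by (intro mult_left_mono Sup_upper) (blast, simp)
      finally show "(\<Sum>\<^sub>\<infinity>i\<in>I. bowen_weight T f t (\<nu> i) (x i)) \<le> ennreal (exp (- real N * (t - s))) *
         Sup {\<Sum>\<^sub>\<infinity>i\<in>I. bowen_weight T f s (\<nu> i) (x i) | (I :: nat set) \<nu> x.
            (\<forall>i\<in>I. N \<le> \<nu> i \<and> x i \<in> Z) \<and>
            disjoint_family_on (\<lambda>i. bowen_cball X T (\<nu> i) (x i) \<epsilon>) I}" unfolding packing_N_def .
    qed
    also have "\<dots> \<le> ennreal (exp (- real N * (t - s))) * packing_N X T f Z \<epsilon> s M"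
      using that by (intro mult_left_mono packing_N_antimono) auto
    finally show ?thesis .
  qed
  then have "packing_pre X T f Z \<epsilon> t \<le> 0"
    using assms M by (intro LIMSEQ_le[OF packing_pre_tendsto scale_tendsto_0[of s t "packing_N X T f Z \<epsilon> s M"]]) auto
  then show ?thesis by simp
qed

lemma packing_outer_jump:
  assumes "s < t" "packing_outer X T f Z \<epsilon> s \<noteq> top"
  shows "packing_outer X T f Z \<epsilon> t = 0"
proof -
  have "packing_outer X T f Z \<epsilon> s < top" using assms by (simp add: less_top)
  then obtain Y where Y: "\<forall>i. Y i \<subseteq> mspace (X 0)" "Z \<subseteq> (\<Union>i. Y i)"
     "(\<Sum>i. packing_pre X T f (Y i) \<epsilon> s) < top"
    unfolding packing_outer_def Inf_less_iff by blast
  have "packing_pre X T f (Y i) \<epsilon> s \<noteq> top" for i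
    using ennreal_suminf_lessD[OF Y(3), of i] by simp
  then have "packing_pre X T f (Y i) \<epsilon> t = 0" for i using packing_pre_jump assms by blast
  then have "(\<Sum>i. packing_pre X T f (Y i) \<epsilon> t) = 0" by simp
  then have "packing_outer X T f Z \<epsilon> t \<le> 0"
    unfolding packing_outer_def using Y by (intro Inf_lower) force
  then show ?thesis by simp
qed

lemma bowen_pressure_at_eq_Sup:
  "bowen_pressure_at X T f Z \<epsilon> = Sup (ereal ` {s. bowen_outer X T f Z \<epsilon> s = top})"
  unfolding bowen_pressure_at_def by (rule critical_value_eq) (rule bowen_outer_jump)

lemma packing_pressure_at_eq_Sup:
  "packing_pressure_at X T f Z \<epsilon> = Sup (ereal ` {s. packing_outer X T f Z \<epsilon> s = top})"
  unfolding packing_pressure_at_def by (rule critical_value_eq) (rule packing_outer_jump)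

end

theory Submission
  imports Defs
begin

text \<open>
  All comparisons are made at a fixed scale, up to a constant factor that disappears as the
  scale tends to 0. A set that is spanning at scale \<open>\<epsilon>\<close> gives a cover by open Bowen balls of radius
  \<open>2 * \<epsilon>\<close>, and a maximal separated set is spanning, which gives (1) and (2).
  For the first half of (3), a maximal family of disjoint closed
  balls of radius \<open>\<epsilon>\<close> and common length has centres that are spanning at scale \<open>2 * \<epsilon>\<close>; hence
  finiteness of the packing premeasure on each piece of a countable decomposition makes every piece,
  and so \<open>Z\<close>, null for the Bowen outer measure at any larger exponent. For the second half,
  the centres of equal length in a disjoint family form a separated set, so a packing sum is
  dominated by the tail of a geometric series.
\<close>

subsection \<open>Extended real sums and maximal subsets\<close>

lemma infsum_ennreal_leI:
  fixes f :: "'b \<Rightarrow> ennreal"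
  assumes "\<And>J. finite J \<Longrightarrow> J \<subseteq> A \<Longrightarrow> sum f J \<le> c"
  shows "infsum f A \<le> c"
  by (subst nonneg_infsum_complete, simp) (rule SUP_least, simp add: assms)

lemma sum_le_infsum_ennreal:
  fixes f :: "'b \<Rightarrow> ennreal"
  assumes "finite J" "J \<subseteq> A"
  shows "sum f J \<le> infsum f A"
  by (subst nonneg_infsum_complete, simp) (rule SUP_upper, simp add: assms)

text \<open>Finite partial sums are bounded, so \<open>w\<close> is summable over the reals and has
  countable support; positivity makes that support all of \<open>A\<close>.\<close>

lemma countable_if_infsum_ennreal_finite:
  fixes w :: "'b \<Rightarrow> real"
  assumes pos: "\<And>x. x \<in> A \<Longrightarrow> 0 < w x"
    and fin: "(\<Sum>\<^sub>\<infinity>x\<in>A. ennreal (w x)) < top"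
  shows "countable A"
proof -
  obtain m where m: "(\<Sum>\<^sub>\<infinity>x\<in>A. ennreal (w x)) = ennreal m" "0 \<le> m"
    using fin by (cases "\<Sum>\<^sub>\<infinity>x\<in>A. ennreal (w x)") auto
  have bound: "sum w J \<le> m" if "finite J" "J \<subseteq> A" for J
  proof -
    have "ennreal (sum w J) = (\<Sum>x\<in>J. ennreal (w x))"
      using that pos by (intro sum_ennreal[symmetric]) (auto intro: less_imp_le)
    also have "\<dots> \<le> ennreal m"
      using sum_le_infsum_ennreal[OF that, of "\<lambda>x. ennreal (w x)"] m by simp
    finally show ?thesis using m by (simp add: ennreal_le_iff)
  qed
  have "bdd_above (sum w ` {J. J \<subseteq> A \<and> finite J})"
    by (rule bdd_aboveI2[where M = m]) (use bound in auto)
  then have "w summable_on A"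
    by (intro nonneg_bdd_above_summable_on) (simp_all add: pos less_imp_le)
  then have "countable {x \<in> A. w x \<noteq> 0}" by (rule summable_countable_real)
  moreover have "{x \<in> A. w x \<noteq> 0} = A" using pos by force
  ultimately show ?thesis by simp
qed

text \<open>A finite set of pairs meets finitely many fibres, and each fibre contributes at most its
  own sum. This bounds the weight of a union of countably many covers.\<close>

lemma infsum_Sigma_nat_le:
  fixes w :: "nat \<times> 'b \<Rightarrow> ennreal"
  shows "(\<Sum>\<^sub>\<infinity>p\<in>Sigma UNIV I. w p) \<le> (\<Sum>k. \<Sum>\<^sub>\<infinity>i\<in>I k. w (k, i))"
proof (rule infsum_ennreal_leI)
  fix J assume J: "finite J" "J \<subseteq> Sigma UNIV I"
  have "sum w J = (\<Sum>k\<in>fst ` J. \<Sum>p\<in>{p \<in> J. fst p = k}. w p)"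
    by (rule sum.image_gen) (rule J)
  also have "\<dots> \<le> (\<Sum>k\<in>fst ` J. \<Sum>\<^sub>\<infinity>i\<in>I k. w (k, i))"
  proof (rule sum_mono)
    fix k
    have "(\<Sum>p\<in>{p \<in> J. fst p = k}. w p) = (\<Sum>i\<in>snd ` {p \<in> J. fst p = k}. w (k, i))"
      by (subst sum.reindex) (auto simp: inj_on_def intro!: sum.cong)
    also have "\<dots> \<le> (\<Sum>\<^sub>\<infinity>i\<in>I k. w (k, i))"
      using J by (intro sum_le_infsum_ennreal) auto
    finally show "(\<Sum>p\<in>{p \<in> J. fst p = k}. w p) \<le> (\<Sum>\<^sub>\<infinity>i\<in>I k. w (k, i))" .
  qed
  also have "\<dots> \<le> (\<Sum>k. \<Sum>\<^sub>\<infinity>i\<in>I k. w (k, i))"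
    using J by (intro sum_le_suminf) auto
  finally show "sum w J \<le> (\<Sum>k. \<Sum>\<^sub>\<infinity>i\<in>I k. w (k, i))" .
qed

lemma sum_power_le_geometric_tail:
  fixes r :: real
  assumes "0 \<le> r" "r < 1" "finite A" "A \<subseteq> {N..}"
  shows "(\<Sum>n\<in>A. r ^ n) \<le> r ^ N * (1 / (1 - r))"
proof -
  \<comment> \<open>Truncated subtraction is harmless here: every element of \<open>A\<close> is at
    least \<open>N\<close>.\<close>
  have A: "A = (\<lambda>k. k + N) ` ((\<lambda>n. n - N) ` A)"
    using assms(4) by (force simp: image_image)
  have "(\<Sum>n\<in>A. r ^ n) = (\<Sum>k\<in>(\<lambda>n. n - N) ` A. r ^ (k + N))"
    by (subst A, subst sum.reindex) (auto simp: inj_on_def)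
  also have "\<dots> = r ^ N * (\<Sum>k\<in>(\<lambda>n. n - N) ` A. r ^ k)"
    by (simp add: sum_distrib_left power_add mult.commute)
  also have "\<dots> \<le> r ^ N * (\<Sum>k. r ^ k)"
    using assms by (intro mult_left_mono sum_le_suminf summable_geometric) auto
  also have "(\<Sum>k. r ^ k) = 1 / (1 - r)" using assms by (intro suminf_geometric) auto
  finally show ?thesis .
qed

section \<open>Growth rates, critical exponents and vanishing scales\<close>

text \<open>The conventional values fit: \<open>a = 0\<close> lies below every exponential, and
  \<open>a = top\<close> has infinite logarithm, which the assumption excludes.\<close>

lemma less_exp_if_scaled_log_less:
  assumes "0 < n" "ereal (1 / real n) * log_ennreal a < ereal s"
  shows "a < ennreal (exp (real n * s))"
proof (cases a)
  case (real r)
  show ?thesis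
  proof (cases "r = 0")
    case False
    then have "0 < r" using real by simp
    then have "ln r < real n * s"
      using assms real by (simp add: log_ennreal_def ennreal_eq_0_iff field_simps)
    then have "r < exp (real n * s)" using \<open>0 < r\<close> by (metis exp_less_cancel_iff exp_ln)
    then show ?thesis using real by (simp add: ennreal_less_iff)
  qed (use real in simp)
qed (use assms in \<open>simp add: log_ennreal_def\<close>)

text \<open>Between \<open>B\<close> and any larger \<open>y\<close> there is room for two reals. A
  growth bound is available at \<open>s\<close>, and the gap \<open>t - s\<close> then supplies
  exponential decay.\<close>

lemma critical_exponent_leI:
  assumes "\<And>s t. B < ereal s \<Longrightarrow> s < t \<Longrightarrow> h t = 0"
  shows "Inf (ereal ` {t. h t = 0}) \<le> B"
proof (rule dense_ge)
  fix y assume "B < y"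
  then obtain s where s: "B < ereal s" "ereal s < y" using ereal_dense2 by blast
  then obtain t where t: "ereal s < ereal t" "ereal t < y" using ereal_dense2 by blast
  then have "h t = 0" using assms s by simp
  then have "Inf (ereal ` {t. h t = 0}) \<le> ereal t" by (intro Inf_lower) auto
  with t show "Inf (ereal ` {t. h t = 0}) \<le> y" by simp
qed

text \<open>Multiplication by a positive constant preserves the right-hand neighbourhoods of 0, so
  the factors 2 and 3 lost at a fixed scale disappear in the limit.\<close>

lemma tendsto_at_right_0_le_rescaled:
  fixes g h :: "real \<Rightarrow> ereal"
  assumes "(g \<longlongrightarrow> a) (at_right 0)" "(h \<longlongrightarrow> b) (at_right 0)" "0 < c"
    and "\<And>\<epsilon>. 0 < \<epsilon> \<Longrightarrow> g (c * \<epsilon>) \<le> h \<epsilon>"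
  shows "a \<le> b"
proof (rule tendsto_le[OF trivial_limit_at_right_real assms(2)])
  have "filterlim (\<lambda>\<epsilon>. c * \<epsilon>) (at_right 0) (at_right 0)"
    by (rule filterlim_times_pos[where p = 0]) (use \<open>0 < c\<close> in \<open>auto simp: filterlim_ident\<close>)
  then show "((\<lambda>\<epsilon>. g (c * \<epsilon>)) \<longlongrightarrow> a) (at_right 0)"
    by (rule filterlim_compose[OF assms(1)])
  show "\<forall>\<^sub>F \<epsilon> in at_right 0. g (c * \<epsilon>) \<le> h \<epsilon>"
    using eventually_at_right_less[of "0::real"] by eventually_elim (rule assms(4))
qed

text \<open>Zorn's lemma: unions of chains keep \<open>pairwise R\<close>, and inserting a point
  into a maximal set must break it. The disjunction arises because \<open>R\<close> is not assumed
  symmetric.\<close>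

lemma maximal_pairwise_subset:
  obtains E where "E \<subseteq> A" "pairwise R E"
    "\<And>x. x \<in> A \<Longrightarrow> x \<notin> E \<Longrightarrow> \<exists>y\<in>E. \<not> R x y \<or> \<not> R y x"
proof -
  let ?S = "{E. E \<subseteq> A \<and> pairwise R E}"
  have "\<exists>M\<in>?S. \<forall>E\<in>?S. M \<subseteq> E \<longrightarrow> E = M"
  proof (rule subset_Zorn')
    fix C assume "subset.chain ?S C"
    then have "C \<subseteq> ?S" "chain\<^sub>\<subseteq> C" by (auto simp: subset_chain_def chain_subset_def)
    then show "\<Union>C \<in> ?S" by (auto intro!: pairwise_chain_Union)
  qed
  then obtain M where M: "M \<subseteq> A" "pairwise R M"
    and max: "\<And>E. E \<subseteq> A \<Longrightarrow> pairwise R E \<Longrightarrow> M \<subseteq> E \<Longrightarrow> E = M" by auto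
  show thesis
  proof (rule that[OF M])
    fix x assume x: "x \<in> A" "x \<notin> M"
    then have "\<not> pairwise R (insert x M)" using max[of "insert x M"] M by auto
    then show "\<exists>y\<in>M. \<not> R x y \<or> \<not> R y x" using M by (auto simp: pairwise_insert)
  qed
qed


subsection \<open>Bowen metrics\<close>

lemma orbit_map_in_mspace:
  assumes "nds X T" "x \<in> mspace (X 0)"
  shows "orbit_map T j x \<in> mspace (X j)"
proof (induction j)
  case (Suc j)
  have "continuous_map (mtopology_of (X j)) (mtopology_of (X (Suc j))) (T j)"
    using assms(1) by (simp add: nds_def)
  from continuous_map_image_subset_topspace[OF this] Suc show ?case by auto
qed (simp add: assms)

lemma bowen_dist_commute: "bowen_dist X T n x y = bowen_dist X T n y x"
  by (simp add: bowen_dist_def mdist_commute)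

lemma bowen_dist_le_iff:
  "0 < n \<Longrightarrow> bowen_dist X T n x y \<le> r \<longleftrightarrow>
     (\<forall>j<n. mdist (X j) (orbit_map T j x) (orbit_map T j y) \<le> r)"
  unfolding bowen_dist_def by (subst Max_le_iff) auto

lemma bowen_dist_refl_le:
  assumes "nds X T" "x \<in> mspace (X 0)" "0 < n" "0 \<le> r"
  shows "bowen_dist X T n x x \<le> r"
proof -
  have "mdist (X j) (orbit_map T j x) (orbit_map T j x) = 0" for j
    using orbit_map_in_mspace[OF assms(1,2), of j] by simp
  with assms show ?thesis by (simp add: bowen_dist_le_iff)
qed

lemma bowen_dist_triangle_le:
  assumes "nds X T" "x \<in> mspace (X 0)" "y \<in> mspace (X 0)" "z \<in> mspace (X 0)" "0 < n"
    and xy: "bowen_dist X T n x y \<le> a" and yz: "bowen_dist X T n y z \<le> b"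
  shows "bowen_dist X T n x z \<le> a + b"
proof -
  have "mdist (X j) (orbit_map T j x) (orbit_map T j z) \<le> a + b" if "j < n" for j
  proof -
    have "mdist (X j) (orbit_map T j x) (orbit_map T j z)
        \<le> mdist (X j) (orbit_map T j x) (orbit_map T j y)
          + mdist (X j) (orbit_map T j y) (orbit_map T j z)"
      using assms by (intro mdist_triangle orbit_map_in_mspace)
    also have "\<dots> \<le> a + b"
      using xy yz that \<open>0 < n\<close> by (intro add_mono) (simp_all add: bowen_dist_le_iff)
    finally show ?thesis .
  qed
  with \<open>0 < n\<close> show ?thesis by (simp add: bowen_dist_le_iff)
qed

text \<open>At a common length \<open>n\<close> the factor \<open>exp (- real n * s)\<close> comes
  out of the sum. This links Bowen weights to spanning and separated sums.\<close>

lemma infsum_bowen_weight_le: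
  "(\<Sum>\<^sub>\<infinity>x\<in>F. bowen_weight T f s n x)
     \<le> ennreal (exp (- real n * s)) * (\<Sum>\<^sub>\<infinity>x\<in>F. ennreal (exp (birkhoff_sum T f n x)))"
proof (rule infsum_ennreal_leI)
  fix J assume J: "finite J" "J \<subseteq> F"
  have "(\<Sum>x\<in>J. bowen_weight T f s n x)
      = ennreal (exp (- real n * s)) * (\<Sum>x\<in>J. ennreal (exp (birkhoff_sum T f n x)))"
    unfolding bowen_weight_def sum_distrib_left by (simp only: exp_add ennreal_mult exp_ge_zero)
  also have "\<dots> \<le> ennreal (exp (- real n * s)) * (\<Sum>\<^sub>\<infinity>x\<in>F. ennreal (exp (birkhoff_sum T f n x)))"
    by (intro mult_left_mono sum_le_infsum_ennreal J) simp
  finally show "(\<Sum>x\<in>J. bowen_weight T f s n x) \<le> \<dots>" .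
qed


subsection \<open>Covers by Bowen balls\<close>

text \<open>A family of finite total weight is automatically countable.\<close>

lemma bowen_outer_N_le:
  fixes I :: "'b set"
  assumes "\<And>i. i \<in> I \<Longrightarrow> N \<le> \<nu> i" "\<And>i. i \<in> I \<Longrightarrow> x i \<in> mspace (X 0)"
    and "Z \<subseteq> (\<Union>i\<in>I. bowen_ball X T (\<nu> i) (x i) \<epsilon>)"
  shows "bowen_outer_N X T f Z \<epsilon> s N \<le> (\<Sum>\<^sub>\<infinity>i\<in>I. bowen_weight T f s (\<nu> i) (x i))"
proof (cases "(\<Sum>\<^sub>\<infinity>i\<in>I. bowen_weight T f s (\<nu> i) (x i)) < top")
  case True
  then have "countable I"
    unfolding bowen_weight_def by (rule countable_if_infsum_ennreal_finite[rotated]) simp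
  \<comment> \<open>The definition demands indices in the naturals, so the countable set
    \<open>I\<close> is enumerated by \<open>?g\<close> and read back by \<open>?h\<close>.\<close>
  let ?g = "to_nat_on I" and ?h = "inv_into I (to_nat_on I)"
  have inj: "inj_on ?g I" using \<open>countable I\<close> by (rule inj_on_to_nat_on)
  then have h: "?h (?g i) = i" if "i \<in> I" for i using that by simp
  have "(\<Sum>\<^sub>\<infinity>k\<in>?g ` I. bowen_weight T f s (\<nu> (?h k)) (x (?h k)))
      = (\<Sum>\<^sub>\<infinity>i\<in>I. bowen_weight T f s (\<nu> i) (x i))"
    by (subst infsum_reindex[OF inj]) (auto intro!: infsum_cong simp: h)
  moreover have "bowen_outer_N X T f Z \<epsilon> s N
      \<le> (\<Sum>\<^sub>\<infinity>k\<in>?g ` I. bowen_weight T f s (\<nu> (?h k)) (x (?h k)))"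
    unfolding bowen_outer_N_def
  proof (rule Inf_lower, rule CollectI, intro exI conjI)
    show "\<forall>k\<in>?g ` I. N \<le> \<nu> (?h k) \<and> x (?h k) \<in> mspace (X 0)" using assms h by auto
    show "Z \<subseteq> (\<Union>k\<in>?g ` I. bowen_ball X T (\<nu> (?h k)) (x (?h k)) \<epsilon>)"
      using assms(3) by (simp add: h)
  qed (rule refl)
  ultimately show ?thesis by simp
qed (simp add: not_less top_unique)

text \<open>Spanning uses a non-strict bound and covers use open balls; the strict gap between
  \<open>\<delta>\<close> and \<open>\<epsilon>\<close> bridges the two.\<close>

lemma bowen_outer_N_le_spanning:
  assumes "Z \<subseteq> mspace (X 0)" "spanning X T Z n \<delta> F" "\<delta> < \<epsilon>" "N \<le> n"
  shows "bowen_outer_N X T f Z \<epsilon> s N \<le> (\<Sum>\<^sub>\<infinity>x\<in>F. bowen_weight T f s n x)"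
proof (rule bowen_outer_N_le)
  show "Z \<subseteq> (\<Union>y\<in>F. bowen_ball X T n y \<epsilon>)"
  proof
    fix z assume "z \<in> Z"
    then obtain y where "y \<in> F" "bowen_dist X T n z y \<le> \<delta>"
      using assms(2) by (auto simp: spanning_def)
    then have "z \<in> bowen_ball X T n y \<epsilon>"
      using \<open>z \<in> Z\<close> assms(1,3) bowen_dist_commute[of X T n z y] by (auto simp: bowen_ball_def)
    with \<open>y \<in> F\<close> show "z \<in> (\<Union>y\<in>F. bowen_ball X T n y \<epsilon>)" by blast
  qed
qed (use assms in \<open>auto simp: spanning_def\<close>)

text \<open>The values increase with \<open>N\<close>, so their limit dominates each of
  them.\<close>

lemma bowen_outer_eq_0_iff:
  "bowen_outer X T f Z \<epsilon> s = 0 \<longleftrightarrow> (\<forall>N. bowen_outer_N X T f Z \<epsilon> s N = 0)"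
proof
  assume 0: "bowen_outer X T f Z \<epsilon> s = 0"
  have "bowen_outer_N X T f Z \<epsilon> s N \<le> bowen_outer X T f Z \<epsilon> s" for N
    by (rule incseq_le[OF _ bowen_outer_tendsto]) (simp add: incseq_def bowen_outer_N_mono)
  with 0 show "\<forall>N. bowen_outer_N X T f Z \<epsilon> s N = 0" by (metis le_zero_eq)
next
  assume "\<forall>N. bowen_outer_N X T f Z \<epsilon> s N = 0"
  then have "(\<lambda>N. 0) \<longlonglongrightarrow> bowen_outer X T f Z \<epsilon> s"
    using bowen_outer_tendsto[of X T f Z \<epsilon> s] by simp
  then show "bowen_outer X T f Z \<epsilon> s = 0" using LIMSEQ_unique tendsto_const by metis
qed

text \<open>Countable subadditivity for null sets: cover the \<open>k\<close>-th piece with weight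
  below \<open>e / 2 ^ (k + 1)\<close> and pool the covers.\<close>

lemma bowen_outer_null_UN:
  assumes null: "\<And>k. bowen_outer X T f (Y k) \<epsilon> s = 0" and Z: "Z \<subseteq> (\<Union>k::nat. Y k)"
  shows "bowen_outer X T f Z \<epsilon> s = 0"
  unfolding bowen_outer_eq_0_iff
proof
  fix N
  have "bowen_outer_N X T f Z \<epsilon> s N \<le> 0 + ennreal e" if "0 < e" for e
  proof -
    let ?e = "\<lambda>k. ennreal (e * (1/2) ^ Suc k)"
    define P where "P k I \<nu> x \<longleftrightarrow>
        (\<forall>i\<in>I. N \<le> \<nu> i \<and> x i \<in> mspace (X 0)) \<and>
        Y k \<subseteq> (\<Union>i\<in>I. bowen_ball X T (\<nu> i) (x i) \<epsilon>) \<and>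
        (\<Sum>\<^sub>\<infinity>i\<in>I. bowen_weight T f s (\<nu> i) (x i)) < ?e k"
      for k and I :: "nat set" and \<nu> x
    have "\<exists>I \<nu> x. P k I \<nu> x" for k
    proof -
      have "0 < ?e k" using \<open>0 < e\<close> by (simp add: ennreal_less_zero_iff)
      then have "bowen_outer_N X T f (Y k) \<epsilon> s N < ?e k"
        using null[of k] by (simp add: bowen_outer_eq_0_iff)
      then obtain I :: "nat set" and \<nu> x where
        "\<forall>i\<in>I. N \<le> \<nu> i \<and> x i \<in> mspace (X 0)" "Y k \<subseteq> (\<Union>i\<in>I. bowen_ball X T (\<nu> i) (x i) \<epsilon>)"
        "(\<Sum>\<^sub>\<infinity>i\<in>I. bowen_weight T f s (\<nu> i) (x i)) < ?e k"
        unfolding bowen_outer_N_def Inf_less_iff by blast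
      then show ?thesis unfolding P_def by blast
    qed
    then obtain I \<nu> x where P: "\<And>k. P k (I k) (\<nu> k) (x k)" by metis
    then have I: "\<And>k. \<forall>i\<in>I k. N \<le> \<nu> k i \<and> x k i \<in> mspace (X 0)"
      and cov: "\<And>k. Y k \<subseteq> (\<Union>i\<in>I k. bowen_ball X T (\<nu> k i) (x k i) \<epsilon>)"
      and small: "\<And>k. (\<Sum>\<^sub>\<infinity>i\<in>I k. bowen_weight T f s (\<nu> k i) (x k i)) < ?e k"
      unfolding P_def by blast+
    \<comment> \<open>The pooled family is indexed by pairs, which \<open>bowen_outer_N_le\<close>
      permits.\<close>
    let ?\<nu> = "\<lambda>(k, i). \<nu> k i" and ?x = "\<lambda>(k, i). x k i"
    have "bowen_outer_N X T f Z \<epsilon> s N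
        \<le> (\<Sum>\<^sub>\<infinity>p\<in>Sigma UNIV I. bowen_weight T f s (?\<nu> p) (?x p))"
    proof (rule bowen_outer_N_le)
      show "Z \<subseteq> (\<Union>p\<in>Sigma UNIV I. bowen_ball X T (?\<nu> p) (?x p) \<epsilon>)"
        using Z cov by fastforce
    qed (use I in auto)
    also have "\<dots> \<le> (\<Sum>k. \<Sum>\<^sub>\<infinity>i\<in>I k. bowen_weight T f s (\<nu> k i) (x k i))"
      using infsum_Sigma_nat_le[of "\<lambda>p. bowen_weight T f s (?\<nu> p) (?x p)" I] by simp
    also have "\<dots> \<le> (\<Sum>k. ?e k)"
      by (intro suminf_le less_imp_le small) auto
    also have "\<dots> = ennreal e"
      using sums_mult[OF power_half_series, of e] \<open>0 < e\<close> by (intro suminf_ennreal_eq) auto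
    finally show ?thesis by simp
  qed
  then have "bowen_outer_N X T f Z \<epsilon> s N \<le> 0" by (rule ennreal_le_epsilon)
  then show "bowen_outer_N X T f Z \<epsilon> s N = 0" by simp
qed


subsection \<open>Comparison at a fixed scale\<close>

text \<open>Arbitrarily late \<open>n\<close> have a spanning set of sum below
  \<open>exp (real n * s)\<close>. At exponent \<open>t\<close> it yields a cover of weight at most
  \<open>exp (- real n * (t - s))\<close>, which is arbitrarily small.\<close>

lemma bowen_pressure_at_le_lower_Q_at:
  assumes "Z \<subseteq> mspace (X 0)" "0 < \<epsilon>"
  shows "bowen_pressure_at X T f Z (2 * \<epsilon>) \<le> lower_Q_at X T f Z \<epsilon>"
  unfolding bowen_pressure_at_def
proof (rule critical_exponent_leI)
  fix s t :: real assume s: "lower_Q_at X T f Z \<epsilon> < ereal s" and "s < t"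
  let ?q = "\<lambda>n. ereal (1 / real n) * log_ennreal (spanning_sum X T f Z n \<epsilon>)"
  \<comment> \<open>Infinitely many \<open>n\<close> suffice, because a cover may consist of balls
    of one common length.\<close>
  have freq: "\<exists>\<^sub>F n in sequentially. ?q n < ereal s"
    using s Liminf_bounded[of "ereal s" ?q sequentially]
    by (auto simp: lower_Q_at_def frequently_def not_less simp flip: not_le)
  show "bowen_outer X T f Z (2 * \<epsilon>) t = 0"
    unfolding bowen_outer_eq_0_iff
  proof (rule allI, rule ccontr)
    fix N assume "bowen_outer_N X T f Z (2 * \<epsilon>) t N \<noteq> 0"
    then have pos: "0 < bowen_outer_N X T f Z (2 * \<epsilon>) t N" by (simp add: zero_less_iff_neq_zero)
    have "(\<lambda>n. ennreal (exp (- real n * (t - s)))) \<longlonglongrightarrow> 0"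
      using scale_tendsto_0[OF \<open>s < t\<close>, of 1] by simp
    then have "\<forall>\<^sub>F n in sequentially.
        ennreal (exp (- real n * (t - s))) < bowen_outer_N X T f Z (2 * \<epsilon>) t N"
      by (rule order_tendstoD(2)) (rule pos)
    \<comment> \<open>The 1 makes \<open>n\<close> positive, as the passage from logarithms to
      exponentials requires.\<close>
    moreover have "\<forall>\<^sub>F n in sequentially. max N 1 \<le> n" by (rule eventually_ge_at_top)
    ultimately obtain n where n: "?q n < ereal s" "max N 1 \<le> n"
      and less: "ennreal (exp (- real n * (t - s))) < bowen_outer_N X T f Z (2 * \<epsilon>) t N"
      using frequently_ex[OF frequently_eventually_frequently[OF freq eventually_conj]] by blast
    have "spanning_sum X T f Z n \<epsilon> < ennreal (exp (real n * s))"
      using n by (intro less_exp_if_scaled_log_less) auto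
    then obtain F where F: "spanning X T Z n \<epsilon> F"
      "(\<Sum>\<^sub>\<infinity>x\<in>F. ennreal (exp (birkhoff_sum T f n x))) < ennreal (exp (real n * s))"
      by (auto simp: spanning_sum_def INF_less_iff)
    have "bowen_outer_N X T f Z (2 * \<epsilon>) t N \<le> (\<Sum>\<^sub>\<infinity>x\<in>F. bowen_weight T f t n x)"
      using assms F n by (intro bowen_outer_N_le_spanning) auto
    also have "\<dots> \<le> ennreal (exp (- real n * t)) * (\<Sum>\<^sub>\<infinity>x\<in>F. ennreal (exp (birkhoff_sum T f n x)))"
      by (rule infsum_bowen_weight_le)
    also have "\<dots> \<le> ennreal (exp (- real n * t)) * ennreal (exp (real n * s))"
      using F by (intro mult_left_mono) auto
    also have "\<dots> = ennreal (exp (- real n * (t - s)))"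
      by (simp add: algebra_simps flip: ennreal_mult exp_add)
    finally show False using less by simp
  qed
qed

text \<open>One maximal separated set competes both in the infimum over spanning sets and in the
  supremum over separated sets.\<close>

lemma spanning_sum_le_separated_sum:
  assumes "nds X T" "Z \<subseteq> mspace (X 0)" "0 < n" "0 < \<epsilon>"
  shows "spanning_sum X T f Z n \<epsilon> \<le> separated_sum X T f Z n \<epsilon>"
proof -
  obtain E where E: "E \<subseteq> Z" "pairwise (\<lambda>x y. \<epsilon> < bowen_dist X T n x y) E"
    and max: "\<And>x. x \<in> Z \<Longrightarrow> x \<notin> E \<Longrightarrow>
      \<exists>y\<in>E. \<not> \<epsilon> < bowen_dist X T n x y \<or> \<not> \<epsilon> < bowen_dist X T n y x"
    using maximal_pairwise_subset by metis
  have sep: "separated X T Z n \<epsilon> E" using E by (auto simp: separated_def pairwise_def)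
  have "\<exists>y\<in>E. bowen_dist X T n x y \<le> \<epsilon>" if "x \<in> Z" for x
  proof (cases "x \<in> E")
    case True
    then show ?thesis using bowen_dist_refl_le[OF assms(1), of x n \<epsilon>] that assms by force
  next
    case False
    then show ?thesis using max[OF that] by (auto simp: bowen_dist_commute not_less)
  qed
  then have span: "spanning X T Z n \<epsilon> E" using E assms by (auto simp: spanning_def)
  have "spanning_sum X T f Z n \<epsilon> \<le> (\<Sum>\<^sub>\<infinity>x\<in>E. ennreal (exp (birkhoff_sum T f n x)))"
    unfolding spanning_sum_def using span by (intro INF_lower) simp
  also have "\<dots> \<le> separated_sum X T f Z n \<epsilon>"
    unfolding separated_sum_def using sep by (intro SUP_upper) simp
  finally show ?thesis .
qed

lemma lower_Q_at_le_lower_P_at: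
  assumes "nds X T" "Z \<subseteq> mspace (X 0)" "0 < \<epsilon>"
  shows "lower_Q_at X T f Z \<epsilon> \<le> lower_P_at X T f Z \<epsilon>"
  unfolding lower_Q_at_def lower_P_at_def
proof (rule Liminf_mono)
  show "\<forall>\<^sub>F n in sequentially. ereal (1 / real n) * log_ennreal (spanning_sum X T f Z n \<epsilon>)
      \<le> ereal (1 / real n) * log_ennreal (separated_sum X T f Z n \<epsilon>)"
    \<comment> \<open>The sums are compared for positive \<open>n\<close> only; a single term does
      not affect the liminf.\<close>
    using eventually_gt_at_top[of 0]
    by eventually_elim (use assms in \<open>auto intro!: scaled_log_mono spanning_sum_le_separated_sum\<close>)
qed

section \<open>Bowen pressure against packing pressure\<close>

text \<open>Only finite subfamilies have to be realised as packings, so no countability of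
  \<open>E\<close> has to be established.\<close>

lemma infsum_le_packing_N:
  assumes "E \<subseteq> Z" "N \<le> n" and disj: "disjoint_family_on (\<lambda>x. bowen_cball X T n x \<epsilon>) E"
  shows "(\<Sum>\<^sub>\<infinity>x\<in>E. bowen_weight T f s n x) \<le> packing_N X T f Z \<epsilon> s N"
proof (rule infsum_ennreal_leI)
  fix J assume J: "finite J" "J \<subseteq> E"
  let ?g = "to_nat_on J" and ?h = "inv_into J (to_nat_on J)"
  have inj: "inj_on ?g J" using J by (intro inj_on_to_nat_on countable_finite)
  then have h: "?h (?g i) = i" if "i \<in> J" for i using that by simp
  have "(\<Sum>x\<in>J. bowen_weight T f s n x) = (\<Sum>\<^sub>\<infinity>k\<in>?g ` J. bowen_weight T f s n (?h k))"
    using J by (simp add: sum.reindex[OF inj] h)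
  also have "\<dots> \<le> packing_N X T f Z \<epsilon> s N"
    unfolding packing_N_def
  proof (rule Sup_upper, rule CollectI, intro exI conjI)
    show "\<forall>k\<in>?g ` J. N \<le> n \<and> ?h k \<in> Z" using assms J h by auto
    show "disjoint_family_on (\<lambda>k. bowen_cball X T n (?h k) \<epsilon>) (?g ` J)"
      unfolding disjoint_family_on_def
    proof (intro ballI impI)
      fix k l assume "k \<in> ?g ` J" "l \<in> ?g ` J" "k \<noteq> l"
      then obtain i j where "i \<in> E" "j \<in> E" "i \<noteq> j" "?h k = i" "?h l = j"
        using J h by auto
      with disj show "bowen_cball X T n (?h k) \<epsilon> \<inter> bowen_cball X T n (?h l) \<epsilon> = {}"
        by (simp add: disjoint_family_on_def)
    qed
  qed (rule refl)
  finally show "(\<Sum>x\<in>J. bowen_weight T f s n x) \<le> packing_N X T f Z \<epsilon> s N" .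
qed

text \<open>The centres of a maximal disjoint family of length \<open>N\<close> serve twice: as a
  packing, and as a cover. Intersecting closed balls have centres within
  \<open>2 * \<epsilon>\<close>; the third \<open>\<epsilon>\<close> makes the covering balls
  open.\<close>

lemma bowen_outer_le_packing_pre:
  assumes "nds X T" "Z \<subseteq> mspace (X 0)" "0 < \<epsilon>"
  shows "bowen_outer X T f Z (3 * \<epsilon>) s \<le> packing_pre X T f Z \<epsilon> s"
proof (rule LIMSEQ_le[OF bowen_outer_tendsto packing_pre_tendsto], intro exI[of _ 1] allI impI)
  fix N :: nat assume "1 \<le> N"
  obtain E where E: "E \<subseteq> Z"
    and disj: "pairwise (\<lambda>x y. bowen_cball X T N x \<epsilon> \<inter> bowen_cball X T N y \<epsilon> = {}) E"
    and max: "\<And>x. x \<in> Z \<Longrightarrow> x \<notin> E \<Longrightarrow>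
      \<exists>y\<in>E. bowen_cball X T N x \<epsilon> \<inter> bowen_cball X T N y \<epsilon> \<noteq> {}
          \<or> bowen_cball X T N y \<epsilon> \<inter> bowen_cball X T N x \<epsilon> \<noteq> {}"
    using maximal_pairwise_subset
      [of Z "\<lambda>x y. bowen_cball X T N x \<epsilon> \<inter> bowen_cball X T N y \<epsilon> = {}"] by metis
  have "\<exists>y\<in>E. bowen_dist X T N x y \<le> 2 * \<epsilon>" if "x \<in> Z" for x
  proof (cases "x \<in> E")
    case True
    then show ?thesis
      using bowen_dist_refl_le[OF assms(1), of x N "2 * \<epsilon>"] that assms \<open>1 \<le> N\<close> by force
  next
    case False
    then obtain y where "y \<in> E" "bowen_cball X T N x \<epsilon> \<inter> bowen_cball X T N y \<epsilon> \<noteq> {}"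
      using max[OF \<open>x \<in> Z\<close>] by (auto simp: Int_commute)
    then obtain z where yz: "y \<in> E" "z \<in> bowen_cball X T N x \<epsilon>" "z \<in> bowen_cball X T N y \<epsilon>"
      by blast
    then have "bowen_dist X T N x y \<le> \<epsilon> + \<epsilon>"
      using that E assms \<open>1 \<le> N\<close>
      by (intro bowen_dist_triangle_le[of X T x z y])
        (auto simp: bowen_cball_def bowen_dist_commute[of X T N z])
    with yz show ?thesis by auto
  qed
  then have "spanning X T Z N (2 * \<epsilon>) E" using E assms by (auto simp: spanning_def)
  then have "bowen_outer_N X T f Z (3 * \<epsilon>) s N \<le> (\<Sum>\<^sub>\<infinity>x\<in>E. bowen_weight T f s N x)"
    using assms by (intro bowen_outer_N_le_spanning) auto
  also have "\<dots> \<le> packing_N X T f Z \<epsilon> s N"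
    using E disj by (intro infsum_le_packing_N) (auto simp: disjoint_family_on_def pairwise_def)
  finally show "bowen_outer_N X T f Z (3 * \<epsilon>) s N \<le> packing_N X T f Z \<epsilon> s N" .
qed

lemma bowen_pressure_at_le_packing_pressure_at:
  assumes "nds X T" "0 < \<epsilon>"
  shows "bowen_pressure_at X T f Z (3 * \<epsilon>) \<le> packing_pressure_at X T f Z \<epsilon>"
  unfolding bowen_pressure_at_def
proof (rule critical_exponent_leI)
  fix s t :: real assume "packing_pressure_at X T f Z \<epsilon> < ereal s" "s < t"
  then obtain r where r: "packing_outer X T f Z \<epsilon> r = 0" "r < s"
    by (auto simp: packing_pressure_at_def Inf_less_iff)
  then have "packing_outer X T f Z \<epsilon> r < top" by simp
  then obtain Y where Y: "\<forall>i. Y i \<subseteq> mspace (X 0)" "Z \<subseteq> (\<Union>i. Y i)"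
     "(\<Sum>i. packing_pre X T f (Y i) \<epsilon> r) < top"
    unfolding packing_outer_def Inf_less_iff by blast
  \<comment> \<open>Each premeasure is finite at \<open>r\<close> as a term of a finite sum, hence
    zero at the larger exponent \<open>t\<close>.\<close>
  have "packing_pre X T f (Y i) \<epsilon> t = 0" for i
    using ennreal_suminf_lessD[OF Y(3), of i] r \<open>s < t\<close> by (intro packing_pre_jump[of r]) auto
  then have "bowen_outer X T f (Y i) (3 * \<epsilon>) t = 0" for i
    using bowen_outer_le_packing_pre[OF assms(1) _ assms(2), of "Y i" f t] Y(1)
    by (metis le_zero_eq)
  then show "bowen_outer X T f Z (3 * \<epsilon>) t = 0" using Y(2) by (rule bowen_outer_null_UN)
qed

section \<open>Packing pressure against upper separated pressure\<close>

text \<open>The trivial decomposition, \<open>Z\<close> followed by empty pieces, is admissible.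
  Empty pieces cost nothing, since a packing of the empty set has no balls.\<close>

lemma packing_outer_le_packing_pre:
  assumes "Z \<subseteq> mspace (X 0)"
  shows "packing_outer X T f Z \<epsilon> s \<le> packing_pre X T f Z \<epsilon> s"
proof -
  have "packing_N X T f {} \<epsilon> s N \<le> 0" for N
    unfolding packing_N_def by (rule Sup_least) auto
  then have "(\<lambda>N. 0) \<longlonglongrightarrow> packing_pre X T f {} \<epsilon> s"
    using packing_pre_tendsto[of X T f "{}" \<epsilon> s] by simp
  then have empty: "packing_pre X T f {} \<epsilon> s = 0" using LIMSEQ_unique tendsto_const by metis
  let ?Y = "\<lambda>i::nat. if i = 0 then Z else {}"
  have "packing_outer X T f Z \<epsilon> s \<le> (\<Sum>i. packing_pre X T f (?Y i) \<epsilon> s)"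
    unfolding packing_outer_def
    by (rule Inf_lower) (use assms in \<open>auto intro!: exI[of _ ?Y] split: if_splits\<close>)
  also have "\<dots> = (\<Sum>i\<in>{0}. packing_pre X T f (?Y i) \<epsilon> s)"
    by (rule suminf_finite) (auto simp: empty)
  finally show ?thesis by simp
qed

lemma packing_pressure_at_le_upper_P_at:
  assumes "nds X T" "Z \<subseteq> mspace (X 0)" "0 < \<epsilon>"
  shows "packing_pressure_at X T f Z \<epsilon> \<le> upper_P_at X T f Z \<epsilon>"
  unfolding packing_pressure_at_def
proof (rule critical_exponent_leI)
  fix s t :: real assume s: "upper_P_at X T f Z \<epsilon> < ereal s" and "s < t"
  have "\<forall>\<^sub>F n in sequentially.
      ereal (1 / real n) * log_ennreal (separated_sum X T f Z n \<epsilon>) < ereal s"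
    using s unfolding upper_P_at_def by (rule Limsup_lessD)
  then obtain M where M: "\<And>n. M \<le> n \<Longrightarrow>
      ereal (1 / real n) * log_ennreal (separated_sum X T f Z n \<epsilon>) < ereal s"
    by (auto simp: eventually_sequentially)
  \<comment> \<open>The ratio of the geometric series: all balls of length \<open>n\<close> together
    will weigh at most \<open>r ^ n\<close> at exponent \<open>t\<close>.\<close>
  define r where "r = exp (- (t - s))"
  have r: "0 \<le> r" "r < 1" using \<open>s < t\<close> by (auto simp: r_def)
  have rpow: "exp (- real n * (t - s)) = r ^ n" for n
    unfolding r_def by (simp flip: exp_of_nat_mult add: algebra_simps)
  have level: "ennreal (exp (- real n * t)) * separated_sum X T f Z n \<epsilon> \<le> ennreal (r ^ n)"
    if "max M 1 \<le> n" for n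
  proof -
    have "ennreal (exp (- real n * t)) * separated_sum X T f Z n \<epsilon>
        \<le> ennreal (exp (- real n * t)) * ennreal (exp (real n * s))"
      using that by (intro mult_left_mono less_imp_le[OF less_exp_if_scaled_log_less] M) auto
    also have "\<dots> = ennreal (exp (- real n * (t - s)))"
      by (simp add: algebra_simps flip: ennreal_mult exp_add)
    finally show ?thesis by (simp only: rpow)
  qed
  have "packing_N X T f Z \<epsilon> t N \<le> ennreal (exp (- real N * (t - s))) * ennreal (1 / (1 - r))"
    if N: "max M 1 \<le> N" for N
    unfolding packing_N_def
  proof (rule Sup_least, clarify, rule infsum_ennreal_leI)
    fix I J :: "nat set" and \<nu> x
    assume I: "\<forall>i\<in>I. N \<le> \<nu> i \<and> x i \<in> Z"
      and disj: "disjoint_family_on (\<lambda>i. bowen_cball X T (\<nu> i) (x i) \<epsilon>) I"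
      and J: "finite J" "J \<subseteq> I"
    \<comment> \<open>A packing may mix lengths, so it is split into groups of equal length.\<close>
    have "(\<Sum>i\<in>J. bowen_weight T f t (\<nu> i) (x i))
        = (\<Sum>n\<in>\<nu> ` J. \<Sum>i\<in>{i \<in> J. \<nu> i = n}. bowen_weight T f t (\<nu> i) (x i))"
      by (rule sum.image_gen) (rule J)
    also have "\<dots> \<le> (\<Sum>n\<in>\<nu> ` J. ennreal (r ^ n))"
    proof (rule sum_mono)
      fix n assume "n \<in> \<nu> ` J"
      then have n: "max M 1 \<le> n" using I J N by force
      let ?J = "{i \<in> J. \<nu> i = n}"
      \<comment> \<open>The centre \<open>x j\<close> lies in its own ball, so disjointness keeps it
        out of the closed ball around \<open>x i\<close>.\<close>
      have far: "\<epsilon> < bowen_dist X T n (x i) (x j)" if "i \<in> ?J" "j \<in> ?J" "i \<noteq> j" for i j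
      proof (rule ccontr)
        assume "\<not> \<epsilon> < bowen_dist X T n (x i) (x j)"
        moreover have "x j \<in> mspace (X 0)" using that I J assms by auto
        ultimately have "x j \<in> bowen_cball X T (\<nu> i) (x i) \<epsilon> \<inter> bowen_cball X T (\<nu> j) (x j) \<epsilon>"
          using that n assms bowen_dist_refl_le[OF assms(1), of "x j" n \<epsilon>]
          by (auto simp: bowen_cball_def)
        with disj that J show False unfolding disjoint_family_on_def by blast
      qed
      \<comment> \<open>A repeated centre would make two balls meet, so summing over indices agrees
        with summing over the set of centres.\<close>
      have inj: "inj_on x ?J"
      proof (rule inj_onI, rule ccontr)
        fix i j assume ij: "i \<in> ?J" "j \<in> ?J" "x i = x j" "i \<noteq> j"
        then have "x j \<in> mspace (X 0)" using I J assms by auto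
        then show False
          using far[OF ij(1,2,4)] ij(3) bowen_dist_refl_le[OF assms(1), of "x j" n \<epsilon>] n assms
          by auto
      qed
      have "separated X T Z n \<epsilon> (x ` ?J)"
        using far I J by (auto simp: separated_def)
      then have sep: "(\<Sum>\<^sub>\<infinity>y\<in>x ` ?J. ennreal (exp (birkhoff_sum T f n y)))
          \<le> separated_sum X T f Z n \<epsilon>"
        unfolding separated_sum_def by (intro SUP_upper) simp
      have "(\<Sum>i\<in>?J. bowen_weight T f t (\<nu> i) (x i)) = (\<Sum>y\<in>x ` ?J. bowen_weight T f t n y)"
        by (simp add: sum.reindex[OF inj])
      also have "\<dots> = (\<Sum>\<^sub>\<infinity>y\<in>x ` ?J. bowen_weight T f t n y)" using J by simp
      also have "\<dots> \<le> ennreal (exp (- real n * t)) *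
          (\<Sum>\<^sub>\<infinity>y\<in>x ` ?J. ennreal (exp (birkhoff_sum T f n y)))"
        by (rule infsum_bowen_weight_le)
      also have "\<dots> \<le> ennreal (exp (- real n * t)) * separated_sum X T f Z n \<epsilon>"
        using sep by (intro mult_left_mono) auto
      also have "\<dots> \<le> ennreal (r ^ n)" using n by (rule level)
      finally show "(\<Sum>i\<in>?J. bowen_weight T f t (\<nu> i) (x i)) \<le> ennreal (r ^ n)" .
    qed
    also have "\<dots> = ennreal (\<Sum>n\<in>\<nu> ` J. r ^ n)" using r by (intro sum_ennreal) simp
    also have "\<dots> \<le> ennreal (r ^ N * (1 / (1 - r)))"
      using r I J by (intro ennreal_leI sum_power_le_geometric_tail) auto
    also have "\<dots> = ennreal (exp (- real N * (t - s))) * ennreal (1 / (1 - r))"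
      unfolding rpow using r by (intro ennreal_mult) auto
    finally show "(\<Sum>i\<in>J. bowen_weight T f t (\<nu> i) (x i)) \<le> \<dots>" .
  qed
  then have "packing_pre X T f Z \<epsilon> t \<le> 0"
    by (intro LIMSEQ_le[OF packing_pre_tendsto
          scale_tendsto_0[OF \<open>s < t\<close>, of "ennreal (1 / (1 - r))"]])
      (auto intro!: exI[of _ "max M 1"])
  with packing_outer_le_packing_pre[of Z X T f \<epsilon> t, OF assms(2)] show "packing_outer X T f Z \<epsilon> t = 0"
    by simp
qed

section \<open>Passage to vanishing scale\<close>

theorem proposition4p7:
  fixes X :: "nat \<Rightarrow> 'a metric" and T :: "nat \<Rightarrow> 'a \<Rightarrow> 'a"
    and f :: "nat \<Rightarrow> 'a \<Rightarrow> real" and Z :: "'a set"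
  assumes "nds X T"
    and "Z \<subseteq> mspace (X 0)"
    and "f \<in> cont_seq X"
  shows "(bowen_pressure X T f Z \<le> lower_Q X T f Z \<and> lower_Q X T f Z \<le> upper_Q X T f Z) \<and>
         (bowen_pressure X T f Z \<le> lower_P X T f Z \<and> lower_P X T f Z \<le> upper_P X T f Z) \<and>
         (bowen_pressure X T f Z \<le> packing_pressure X T f Z \<and>
          packing_pressure X T f Z \<le> upper_P X T f Z)"
proof -
  note lims = Q_P_tendsto[of X T f Z] bowen_packing_pressure_tendsto[of X T f Z]
  have BQ: "bowen_pressure X T f Z \<le> lower_Q X T f Z"
    using assms by (intro tendsto_at_right_0_le_rescaled[OF lims(5,1), of 2]
        bowen_pressure_at_le_lower_Q_at) auto
  \<comment> \<open>This auxiliary inequality is chained with \<open>BQ\<close> to bound the Bowen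
    pressure by \<open>lower_P\<close>.\<close>
  have QP: "lower_Q X T f Z \<le> lower_P X T f Z"
    using assms by (intro tendsto_at_right_0_le_rescaled[OF lims(1,3), of 1])
      (auto intro: lower_Q_at_le_lower_P_at)
  have QQ: "lower_Q X T f Z \<le> upper_Q X T f Z"
    by (rule tendsto_at_right_0_le_rescaled[OF lims(1,2), of 1])
      (auto simp: lower_Q_at_def upper_Q_at_def intro!: Liminf_le_Limsup)
  have PP: "lower_P X T f Z \<le> upper_P X T f Z"
    by (rule tendsto_at_right_0_le_rescaled[OF lims(3,4), of 1])
      (auto simp: lower_P_at_def upper_P_at_def intro!: Liminf_le_Limsup)
  have BK: "bowen_pressure X T f Z \<le> packing_pressure X T f Z"
    using assms by (intro tendsto_at_right_0_le_rescaled[OF lims(5,6), of 3]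
        bowen_pressure_at_le_packing_pressure_at) auto
  have KP: "packing_pressure X T f Z \<le> upper_P X T f Z"
    using assms by (intro tendsto_at_right_0_le_rescaled[OF lims(6,4), of 1])
      (auto intro: packing_pressure_at_le_upper_P_at)
  show ?thesis using BQ QP QQ PP BK KP order_trans[OF BQ QP] by blast
qed

end
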